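(* Let $G=(A,E)$ be a directed graph (with $A$ possibly infinite) with positive edge lengths and maximum out-degree $D$, $1\le D<\infty$, and let $\mathbf C$ be an edge-coloring of $G$. If $\mathbf C$ is admissible, then for every $T$, all actions $a^1,\dots,a^T\in A$ and all utility functions $u^1,\dots,u^T:A\to\mathbb{R}$, $$R^T_{\mathrm{localexternal}}\le R^T_{\mathrm{localcolor}}/D .$$
   Context: Let $c(i,j)>0$ be the length of edge $(i,j)$ and $d(a,b)$ the total length of a shortest directed path from $a$ to $b$ (assumed to exist for all pairs). Write $x^+=\max(x,0)$ and $R^T_{a,b}=\sum_{t=1}^T\mathbf 1(a^t=a)(u^t(b)-u^t(a))$. For infinite $A$, $\max$ means supremum; only finitely many $R^T_{i,j}$, $(i,j)\in E$, are nonzero. $E^b=\{(i,j)\in E: d(i,b)=c(i,j)+d(j,b)\}$ is the set of edges on a shortest path to $b$, and $R^T_{\mathrm{localexternal}}=\max_{b\in A}\big(\sum_{(i,j)\in E^b}R^T_{i,j}/D\big)^+$. An edge-coloring $\mathbf C=\{C_i\}_{i=1,2,\dots}$ of $G$ is a partition of $E$. It is admissible if for all $b\in A$, $C\in\mathbf C$, and $(i,j),(i',j')\in C$: $d(i,b)=c(i,j)+d(j,b)\iff d(i',b)=c(i',j')+d(j',b)$. The local colored regret is $R^T_{\mathrm{localcolor}}=\sum_{C\in\mathbf C}\big(\sum_{(i,j)\in C}R^T_{i,j}\big)^+$. *)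

theory Defs
  imports
    "Graph_Theory.Pair_Digraph"
    "Graph_Theory.Shortest_Path"
    "HOL-Analysis.Infinite_Sum"
begin

text \<open>
  A graph \<open>(A, E)\<close> with \<open>E \<subseteq> A \<times> A\<close> is a \<open>pair_wf_digraph\<close>: \<open>A = pverts G\<close>, \<open>E = parcs G\<close>.
  Neither set need be finite. The function \<open>with_proj\<close> embeds it into general digraphs.
\<close>

text \<open>
  The library's \<open>\<mu>\<close> is an infimum over walks, in the extended reals. It is the total length of a
  shortest path as soon as \<open>shortest_paths_exist\<close> below holds; that condition also makes it finite.
\<close>

definition graph_dist :: "'a pair_pre_digraph \<Rightarrow> ('a \<times> 'a \<Rightarrow> real) \<Rightarrow> 'a \<Rightarrow> 'a \<Rightarrow> ereal" where
  "graph_dist G c a b = wf_digraph.\<mu> (with_proj G) c a b"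

definition shortest_paths_exist :: "'a pair_pre_digraph \<Rightarrow> ('a \<times> 'a \<Rightarrow> real) \<Rightarrow> bool" where
  "shortest_paths_exist G c \<longleftrightarrow>
    (\<forall>a\<in>pverts G. \<forall>b\<in>pverts G. \<exists>p. pre_digraph.apath (with_proj G) a p b \<and>
      ereal (wf_digraph.awalk_cost c p) = graph_dist G c a b)"

text \<open>
  The finiteness condition is explicit because \<open>out_degree\<close> is a cardinality, hence \<open>0\<close> for
  infinitely many outgoing arcs.
\<close>

definition is_max_out_degree :: "'a pair_pre_digraph \<Rightarrow> nat \<Rightarrow> bool" where
  "is_max_out_degree G D \<longleftrightarrow>
    (\<forall>a\<in>pverts G. finite (out_arcs (with_proj G) a) \<and> out_degree (with_proj G) a \<le> D) \<and>
    (\<exists>a\<in>pverts G. out_degree (with_proj G) a = D)"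

definition shortest_path_edges ::
    "'a pair_pre_digraph \<Rightarrow> ('a \<times> 'a \<Rightarrow> real) \<Rightarrow> 'a \<Rightarrow> ('a \<times> 'a) set" where
  "shortest_path_edges G c b =
    {(i, j) \<in> parcs G. graph_dist G c i b = ereal (c (i, j)) + graph_dist G c j b}"

definition edge_coloring :: "'a pair_pre_digraph \<Rightarrow> ('a \<times> 'a) set set \<Rightarrow> bool" where
  "edge_coloring G \<C> \<longleftrightarrow> partition_on (parcs G) \<C>"

definition admissible ::
    "'a pair_pre_digraph \<Rightarrow> ('a \<times> 'a \<Rightarrow> real) \<Rightarrow> ('a \<times> 'a) set set \<Rightarrow> bool" where
  "admissible G c \<C> \<longleftrightarrow>
    (\<forall>b\<in>pverts G. \<forall>C\<in>\<C>. \<forall>(i, j)\<in>C. \<forall>(i', j')\<in>C.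
      graph_dist G c i b = ereal (c (i, j)) + graph_dist G c j b \<longleftrightarrow>
      graph_dist G c i' b = ereal (c (i', j')) + graph_dist G c j' b)"

text \<open>Only the rounds \<open>1, \<dots>, T\<close> of the sequences \<open>a\<close> (actions) and \<open>u\<close> (utilities) matter.\<close>

definition regret :: "(nat \<Rightarrow> 'a) \<Rightarrow> (nat \<Rightarrow> 'a \<Rightarrow> real) \<Rightarrow> nat \<Rightarrow> 'a \<Rightarrow> 'a \<Rightarrow> real" where
  "regret a u T x y = (\<Sum>t=1..T. of_bool (a t = x) * (u t y - u t x))"

text \<open>
  With finite out-degrees, \<open>regret a u T i j\<close> is nonzero for only finitely many edges \<open>(i, j)\<close>.
  So all infinite sums below have finite support, and the supremum is taken over a bounded set.
\<close>

definition local_external_regret ::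
    "'a pair_pre_digraph \<Rightarrow> ('a \<times> 'a \<Rightarrow> real) \<Rightarrow> nat \<Rightarrow>
     (nat \<Rightarrow> 'a) \<Rightarrow> (nat \<Rightarrow> 'a \<Rightarrow> real) \<Rightarrow> nat \<Rightarrow> real" where
  "local_external_regret G c D a u T =
    (SUP b\<in>pverts G.
      max (\<Sum>\<^sub>\<infinity>(i, j)\<in>shortest_path_edges G c b. regret a u T i j / real D) 0)"

definition local_color_regret ::
    "('a \<times> 'a) set set \<Rightarrow> (nat \<Rightarrow> 'a) \<Rightarrow> (nat \<Rightarrow> 'a \<Rightarrow> real) \<Rightarrow> nat \<Rightarrow> real" where
  "local_color_regret \<C> a u T =
    (\<Sum>\<^sub>\<infinity>C\<in>\<C>. max (\<Sum>\<^sub>\<infinity>(i, j)\<in>C. regret a u T i j) 0)"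

end

theory Submission
  imports Defs
begin

text \<open>Admissibility makes each set of shortest-path edges to a target \<open>b\<close> a union
  of color classes. Its total regret is therefore a sum of class totals over some of the classes;
  replacing each total by its positive part and then adding the remaining classes can only increase
  it. This gives a bound independent of \<open>b\<close>, and dividing by \<open>D\<close> and
  taking the supremum finishes the proof. The combinatorial core is
  \<open>infsum_saturated_le_infsum_pos_part\<close>. Infinite sums cause no trouble: regret lives
  on the edges leaving the finitely many played actions, so \<open>infsum_finite_support\<close>
  turns each sum into a finite one.\<close>

lemma infsum_finite_support:
  assumes "finite F" and "\<And>x. x \<in> S - F \<Longrightarrow> f x = 0"
  shows "infsum f S = sum f (S \<inter> F)"
proof -
  have "infsum f S = infsum f (S \<inter> F)"
    using assms(2) by (intro infsum_cong_neutral) auto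
  with assms(1) show ?thesis by simp
qed

text \<open>Since \<open>S\<close> is a union of blocks, its sum splits into block sums, each at
  most its positive part; the blocks outside \<open>S\<close> contribute nonnegative terms.\<close>

lemma infsum_saturated_le_infsum_pos_part:
  fixes f :: "'b \<Rightarrow> real"
  assumes P: "partition_on E P"
    and F: "finite F" "\<And>x. x \<in> E - F \<Longrightarrow> f x = 0"
    and S: "S \<subseteq> E" "\<And>C. C \<in> P \<Longrightarrow> C \<subseteq> S \<or> C \<inter> S = {}"
  shows "infsum f S \<le> (\<Sum>\<^sub>\<infinity>C\<in>P. max (infsum f C) 0)"
proof -
  have E: "E = \<Union>P" and disj: "\<And>C C'. C \<in> P \<Longrightarrow> C' \<in> P \<Longrightarrow> C \<noteq> C' \<Longrightarrow> C \<inter> C' = {}"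
    using P by (auto simp: partition_on_def disjoint_def)
  have block: "infsum f C = sum f (C \<inter> F)" if "C \<in> P" for C
    using that F E by (intro infsum_finite_support) auto
  \<comment> \<open>Only blocks meeting \<open>F\<close> matter. Being disjoint, they have distinct
    nonempty traces on \<open>F\<close>, so \<open>Q\<close> injects into the finite set
    \<open>Pow F\<close>.\<close>
  define Q where "Q = {C \<in> P. C \<inter> F \<noteq> {}}"
  define QS where "QS = {C \<in> Q. C \<subseteq> S}"
  have Q: "Q \<subseteq> P" and QS: "QS \<subseteq> Q" by (auto simp: Q_def QS_def)
  have "finite ((\<lambda>C. C \<inter> F) ` Q)"
    using F(1) by (rule rev_finite_subset[OF finite_Pow_iff[THEN iffD2]]) auto
  moreover have "inj_on (\<lambda>C. C \<inter> F) Q"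
    using disj by (auto simp: Q_def inj_on_def)
  ultimately have finQ: "finite Q" by (rule finite_imageD)
  have "S \<inter> F = (\<Union>C\<in>QS. C \<inter> F)"
  proof (intro equalityI subsetI)
    fix x assume x: "x \<in> S \<inter> F"
    with S(1) E obtain C where "C \<in> P" "x \<in> C" by blast
    \<comment> \<open>The block through \<open>x\<close> meets \<open>S\<close>, hence lies inside
      it.\<close>
    with x S(2)[of C] show "x \<in> (\<Union>C\<in>QS. C \<inter> F)"
      by (auto simp: Q_def QS_def)
  qed (auto simp: QS_def)
  moreover have "sum f (\<Union>C\<in>QS. C \<inter> F) = (\<Sum>C\<in>QS. sum f (C \<inter> F))"
  proof (intro sum.UNION_disjoint ballI impI)
    show "finite QS" using QS finQ by (rule finite_subset)
    show "(C \<inter> F) \<inter> (C' \<inter> F) = {}" if "C \<in> QS" "C' \<in> QS" "C \<noteq> C'" for C C'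
      using disj[of C C'] that Q QS by blast
  qed (use F(1) in simp)
  moreover have "infsum f S = sum f (S \<inter> F)"
    using F S(1) by (intro infsum_finite_support) auto
  ultimately have "infsum f S = (\<Sum>C\<in>QS. sum f (C \<inter> F))" by simp
  also have "\<dots> \<le> (\<Sum>C\<in>QS. max (sum f (C \<inter> F)) 0)"
    by (intro sum_mono) simp
  also have "\<dots> \<le> (\<Sum>C\<in>Q. max (sum f (C \<inter> F)) 0)"
    using finQ QS by (intro sum_mono2) auto
  also have "\<dots> = (\<Sum>C\<in>P \<inter> Q. max (infsum f C) 0)"
    using Q block by (intro sum.cong) auto
  \<comment> \<open>A block outside \<open>Q\<close> has empty trace on \<open>F\<close>, so its sum
    is 0.\<close>
  also have "\<dots> = (\<Sum>\<^sub>\<infinity>C\<in>P. max (infsum f C) 0)"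
    using finQ block by (intro infsum_finite_support[symmetric]) (auto simp: Q_def)
  finally show ?thesis .
qed

lemma regret_eq_0: "x \<notin> a ` {1..T} \<Longrightarrow> regret a u T x y = 0"
  unfolding regret_def by (intro sum.neutral) auto

theorem theorem4:
  fixes G :: "'a pair_pre_digraph"
    and c :: "'a \<times> 'a \<Rightarrow> real"
    and D T :: nat
    and \<C> :: "('a \<times> 'a) set set"
    and a :: "nat \<Rightarrow> 'a"
    and u :: "nat \<Rightarrow> 'a \<Rightarrow> real"
  assumes "pair_wf_digraph G"
    and "\<forall>e\<in>parcs G. c e > 0"
    and "shortest_paths_exist G c"
    and "is_max_out_degree G D"
    and "1 \<le> D"
    and "edge_coloring G \<C>"
    and "admissible G c \<C>"
    and "\<forall>t\<in>{1..T}. a t \<in> pverts G"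
  shows "local_external_regret G c D a u T \<le> local_color_regret \<C> a u T / real D"
proof -
  define f where "f = (\<lambda>(x, y). regret a u T x y)"
  \<comment> \<open>An edge whose tail is never played has regret 0, so \<open>F\<close> carries all
    the regret; the degree bound makes it finite.\<close>
  define F where "F = (\<Union>x\<in>a ` {1..T}. out_arcs (with_proj G) x)"
  have "finite F"
    using assms(4,8) by (auto simp: F_def is_max_out_degree_def)
  have P: "partition_on (parcs G) \<C>"
    using assms(6) by (simp add: edge_coloring_def)
  have vanish: "f e = 0" if "e \<in> parcs G - F" for e
    using that by (cases e) (auto simp: f_def F_def intro!: regret_eq_0)
  have color: "local_color_regret \<C> a u T = (\<Sum>\<^sub>\<infinity>C\<in>\<C>. max (infsum f C) 0)"
    by (simp add: local_color_regret_def f_def)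
  have "max (\<Sum>\<^sub>\<infinity>(i, j)\<in>shortest_path_edges G c b. regret a u T i j / real D) 0
      \<le> local_color_regret \<C> a u T / real D" if "b \<in> pverts G" for b
  proof -
    let ?S = "shortest_path_edges G c b"
    have "?S \<subseteq> parcs G" by (auto simp: shortest_path_edges_def)
    \<comment> \<open>By admissibility, the distance equation defining \<open>?S\<close> holds for
      all edges of \<open>C\<close> or for none.\<close>
    moreover have "C \<subseteq> ?S \<or> C \<inter> ?S = {}" if "C \<in> \<C>" for C
    proof -
      have "C \<subseteq> parcs G" using P that by (auto simp: partition_on_def)
      then show ?thesis
        using assms(7) that \<open>b \<in> pverts G\<close>
        unfolding admissible_def shortest_path_edges_def by fast
    qed
    ultimately have "infsum f ?S \<le> local_color_regret \<C> a u T"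
      unfolding color using P \<open>finite F\<close> vanish
      by (intro infsum_saturated_le_infsum_pos_part) auto
    moreover have "(\<Sum>\<^sub>\<infinity>(i, j)\<in>?S. regret a u T i j / real D) = infsum f ?S / real D"
      by (simp add: f_def case_prod_unfold divide_inverse infsum_cmult_left')
    \<comment> \<open>This handles the case where the maximum with 0 is 0.\<close>
    moreover have "0 \<le> local_color_regret \<C> a u T"
      unfolding color by (intro infsum_nonneg) simp
    ultimately show ?thesis by (simp add: divide_right_mono)
  qed
  \<comment> \<open>Some vertex attains out-degree \<open>D\<close>; \<open>cSUP_least\<close> needs
    a nonempty index set.\<close>
  moreover have "pverts G \<noteq> {}"
    using assms(4) by (auto simp: is_max_out_degree_def)
  ultimately show ?thesis
    unfolding local_external_regret_def by (intro cSUP_least)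
qed

end
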